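(* Let $(C,\Delta,\varepsilon,\alpha)$ be a Hom-coalgebra over a field $k$ and let $\lambda,\nu\in k^{\ast}=k\setminus\{0\}$. Assume that $\alpha$ is involutive, i.e. $\alpha\circ\alpha=\mathrm{id}_C$. Then the linear map $$B: C\otimes C\to C\otimes C,\qquad a\otimes b\mapsto \lambda\,\varepsilon(a)\,b_1\otimes b_2+\nu\,\varepsilon(b)\,a_1\otimes a_2-\lambda\,\alpha(a)\otimes\alpha(b)$$ is invertible, with inverse given by $$B^{-1}: C\otimes C\to C\otimes C,\qquad a\otimes b\mapsto \frac{1}{\nu}\,\varepsilon(a)\,b_1\otimes b_2+\frac{1}{\lambda}\,\varepsilon(b)\,a_1\otimes a_2-\frac{1}{\lambda}\,\alpha(a)\otimes\alpha(b).$$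
   Context: Throughout, $k$ is a fixed field; vector spaces, linear maps and tensor products are over $k$. Sweedler notation $\Delta(c)=c_1\otimes c_2$ (summation understood) is used, with $c_{11}\otimes c_{12}=\Delta(c_1)$, $c_{21}\otimes c_{22}=\Delta(c_2)$. A Hom-coalgebra is a quadruple $(C,\Delta,\varepsilon,\alpha)$ where $C$ is a $k$-linear space, $\Delta:C\to C\otimes C$ and $\varepsilon:C\to k$ are $k$-linear maps, and $\alpha:C\to C$ is a linear endomorphism, such that for all $c\in C$: $\alpha(c)_1\otimes\alpha(c)_2=\alpha(c_1)\otimes\alpha(c_2)$, $\varepsilon\circ\alpha=\varepsilon$, $\alpha(c_1)\otimes c_{21}\otimes c_{22}=c_{11}\otimes c_{12}\otimes\alpha(c_2)$, and $\varepsilon(c_1)c_2=c_1\varepsilon(c_2)=\alpha(c)$. *)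

theory Defs
  imports "HOL-Algebra.AbelCoset" "Jordan_Normal_Form.Missing_VectorSpace"
begin

text \<open>A \<open>module\<close> record has components \<open>mult\<close> and \<open>one\<close>, which are irrelevant for a vector space;
  the values given to them below are arbitrary.\<close>

definition field_space :: "('k, 'r) ring_scheme \<Rightarrow> ('k, 'k) module"
  where "field_space k = \<lparr>carrier = carrier k, mult = mult k, one = one k,
           zero = zero k, add = add k, smult = mult k\<rparr>"

definition free_space :: "('k, 'r) ring_scheme \<Rightarrow> 's set \<Rightarrow> ('k, 's \<Rightarrow> 'k) module"
  where "free_space k S =
    (ring.func_space k S)\<lparr>carrier := {u \<in> S \<rightarrow>\<^sub>E carrier k. finite {s \<in> S. u s \<noteq> \<zero>\<^bsub>k\<^esub>}}\<rparr>"

definition free_gen :: "('k, 'r) ring_scheme \<Rightarrow> 's set \<Rightarrow> 's \<Rightarrow> ('s \<Rightarrow> 'k)"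
  where "free_gen k S s = (\<lambda>t\<in>S. if t = s then \<one>\<^bsub>k\<^esub> else \<zero>\<^bsub>k\<^esub>)"

definition quotient_space :: "('k, 'v, 'e) module_scheme \<Rightarrow> 'v set \<Rightarrow> ('k, 'v set) module"
  where "quotient_space V W = \<lparr>carrier = a_rcosets\<^bsub>V\<^esub> W, mult = (\<lambda>X Y. W), one = W,
           zero = W, add = set_add V, smult = (\<lambda>c X. \<Union>x\<in>X. W +>\<^bsub>V\<^esub> (c \<odot>\<^bsub>V\<^esub> x))\<rparr>"


subsection \<open>Tensor products\<close>

definition tensor_relators ::
  "('k, 'r) ring_scheme \<Rightarrow> ('k, 'm, 'e) module_scheme \<Rightarrow> ('k, 'n, 'f) module_scheme
    \<Rightarrow> ('m \<times> 'n \<Rightarrow> 'k) set"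
  where "tensor_relators k M N =
    (let S = carrier M \<times> carrier N; F = free_space k S; g = free_gen k S in
      {g (x \<oplus>\<^bsub>M\<^esub> x', y) \<ominus>\<^bsub>F\<^esub> (g (x, y) \<oplus>\<^bsub>F\<^esub> g (x', y)) |x x' y.
         x \<in> carrier M \<and> x' \<in> carrier M \<and> y \<in> carrier N}
    \<union> {g (x, y \<oplus>\<^bsub>N\<^esub> y') \<ominus>\<^bsub>F\<^esub> (g (x, y) \<oplus>\<^bsub>F\<^esub> g (x, y')) |x y y'.
         x \<in> carrier M \<and> y \<in> carrier N \<and> y' \<in> carrier N}
    \<union> {g (c \<odot>\<^bsub>M\<^esub> x, y) \<ominus>\<^bsub>F\<^esub> c \<odot>\<^bsub>F\<^esub> g (x, y) |c x y.
         c \<in> carrier k \<and> x \<in> carrier M \<and> y \<in> carrier N}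
    \<union> {g (x, c \<odot>\<^bsub>N\<^esub> y) \<ominus>\<^bsub>F\<^esub> c \<odot>\<^bsub>F\<^esub> g (x, y) |c x y.
         c \<in> carrier k \<and> x \<in> carrier M \<and> y \<in> carrier N})"

definition tensor_null ::
  "('k, 'r) ring_scheme \<Rightarrow> ('k, 'm, 'e) module_scheme \<Rightarrow> ('k, 'n, 'f) module_scheme
    \<Rightarrow> ('m \<times> 'n \<Rightarrow> 'k) set"
  where "tensor_null k M N =
    module.span k (free_space k (carrier M \<times> carrier N)) (tensor_relators k M N)"

definition tensor_space ::
  "('k, 'r) ring_scheme \<Rightarrow> ('k, 'm, 'e) module_scheme \<Rightarrow> ('k, 'n, 'f) module_scheme
    \<Rightarrow> ('k, ('m \<times> 'n \<Rightarrow> 'k) set) module"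
  where "tensor_space k M N =
    quotient_space (free_space k (carrier M \<times> carrier N)) (tensor_null k M N)"

definition tensor ::
  "('k, 'r) ring_scheme \<Rightarrow> ('k, 'm, 'e) module_scheme \<Rightarrow> ('k, 'n, 'f) module_scheme
    \<Rightarrow> 'm \<Rightarrow> 'n \<Rightarrow> ('m \<times> 'n \<Rightarrow> 'k) set"
  where "tensor k M N x y =
    tensor_null k M N +>\<^bsub>free_space k (carrier M \<times> carrier N)\<^esub>
      free_gen k (carrier M \<times> carrier N) (x, y)"

text \<open>The linear map \<open>M \<otimes> N \<rightarrow> P\<close> given on pure tensors by \<open>x \<otimes> y \<mapsto> f x y\<close>; meaningful
  when \<open>f\<close> is bilinear. It is made unique by fixing its value outside the carrier.\<close>

definition tensor_lift ::
  "('k, 'r) ring_scheme \<Rightarrow> ('k, 'm, 'e) module_scheme \<Rightarrow> ('k, 'n, 'f) module_scheme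
    \<Rightarrow> ('k, 'p, 'g) module_scheme \<Rightarrow> ('m \<Rightarrow> 'n \<Rightarrow> 'p) \<Rightarrow> ('m \<times> 'n \<Rightarrow> 'k) set \<Rightarrow> 'p"
  where "tensor_lift k M N P f =
    (THE h. h \<in> extensional (carrier (tensor_space k M N))
       \<and> linear_map k (tensor_space k M N) P h
       \<and> (\<forall>x\<in>carrier M. \<forall>y\<in>carrier N. h (tensor k M N x y) = f x y))"

definition tensor_map ::
  "('k, 'r) ring_scheme \<Rightarrow> ('k, 'm, 'e) module_scheme \<Rightarrow> ('k, 'n, 'f) module_scheme
    \<Rightarrow> ('k, 'p, 'g) module_scheme \<Rightarrow> ('k, 'q, 'h) module_scheme
    \<Rightarrow> ('m \<Rightarrow> 'p) \<Rightarrow> ('n \<Rightarrow> 'q) \<Rightarrow> ('m \<times> 'n \<Rightarrow> 'k) set \<Rightarrow> ('p \<times> 'q \<Rightarrow> 'k) set"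
  where "tensor_map k M N P Q f g =
    tensor_lift k M N (tensor_space k P Q) (\<lambda>x y. tensor k P Q (f x) (g y))"

definition tensor_assoc ::
  "('k, 'r) ring_scheme \<Rightarrow> ('k, 'm, 'e) module_scheme \<Rightarrow> ('k, 'n, 'f) module_scheme
    \<Rightarrow> ('k, 'p, 'g) module_scheme
    \<Rightarrow> (('m \<times> 'n \<Rightarrow> 'k) set \<times> 'p \<Rightarrow> 'k) set \<Rightarrow> ('m \<times> ('n \<times> 'p \<Rightarrow> 'k) set \<Rightarrow> 'k) set"
  where "tensor_assoc k M N P =
    (let NP = tensor_space k N P; T = tensor_space k M NP in
      tensor_lift k (tensor_space k M N) P T
        (\<lambda>t z. tensor_lift k M N T (\<lambda>x y. tensor k M NP x (tensor k N P y z)) t))"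


subsection \<open>Hom-coalgebras\<close>

locale hom_coalgebra =
  C?: vectorspace k C +
  comul: linear_map k C "tensor_space k C C" \<Delta> +
  counit: linear_map k C "field_space k" \<epsilon> +
  twist: linear_map k C C \<alpha>
  for k and C and \<Delta> and \<epsilon> and \<alpha> +
  assumes comul_twist:
      "c \<in> carrier C \<Longrightarrow> \<Delta> (\<alpha> c) = tensor_map k C C C C \<alpha> \<alpha> (\<Delta> c)"
    and counit_twist:
      "c \<in> carrier C \<Longrightarrow> \<epsilon> (\<alpha> c) = \<epsilon> c"
    and hom_coassoc:
      "c \<in> carrier C \<Longrightarrow>
        tensor_map k C C C (tensor_space k C C) \<alpha> \<Delta> (\<Delta> c) =
        tensor_assoc k C C C (tensor_map k C C (tensor_space k C C) C \<Delta> \<alpha> (\<Delta> c))"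
    and counit_left:
      "c \<in> carrier C \<Longrightarrow> tensor_lift k C C C (\<lambda>a b. \<epsilon> a \<odot>\<^bsub>C\<^esub> b) (\<Delta> c) = \<alpha> c"
    and counit_right:
      "c \<in> carrier C \<Longrightarrow> tensor_lift k C C C (\<lambda>a b. \<epsilon> b \<odot>\<^bsub>C\<^esub> a) (\<Delta> c) = \<alpha> c"

end

theory Submission
  imports Defs
begin

text \<open>For scalars \<open>p, q, r\<close> let \<open>R p q r\<close> be the linear endomorphism of \<open>C \<otimes> C\<close> with
  \<open>x \<otimes> y \<mapsto> p \<epsilon>(x) \<Delta>(y) + q \<epsilon>(y) \<Delta>(x) - r \<alpha>(x) \<otimes> \<alpha>(y)\<close>. Both maps of the theorem are of this form, for
  \<open>(l, \<nu>, l)\<close> and for \<open>(1/\<nu>, 1/l, 1/l)\<close>. The counit laws and the compatibility of \<open>\<Delta>\<close> with \<open>\<alpha>\<close>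
  make the image of \<open>\<Delta>\<close> behave like a space of eigenvectors: each of the three summands sends
  \<open>\<Delta>(c)\<close> to a multiple of \<open>\<Delta>(\<alpha>(c))\<close>, so \<open>R p q r (\<Delta>(c)) = (p + q - r) \<Delta>(\<alpha>(c))\<close>
  (lemma \<open>braid_lift_comul\<close>). Hence a composite of two such maps can be computed on pure tensors:
  with \<open>s' = p' + q' - r'\<close> and \<open>\<alpha>\<^sup>2 = id\<close>, the value of \<open>R p' q' r' \<circ> R p q r\<close> at \<open>x \<otimes> y\<close> is
  \<open>(p s' - r p') \<epsilon>(x) \<Delta>(\<alpha>(y)) + (q s' - r q') \<epsilon>(y) \<Delta>(\<alpha>(x)) + r r' (x \<otimes> y)\<close>.
  It is \<open>x \<otimes> y\<close> as soon as \<open>p s' = r p'\<close>, \<open>q s' = r q'\<close> and \<open>r r' = 1\<close>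
  (lemma \<open>braid_lift_inverse\<close>), and the two triples of scalars satisfy these equations in
  either order.

  To say any of this, the universal property of the tensor product is needed: a bilinear map extends
  to a linear map (lemma \<open>tensor_lift_exists\<close>), and whatever holds for pure tensors and is stable
  under sums and multiples holds everywhere (lemma \<open>tensor_space_induct\<close>), which also makes the
  extension unique. Since the tensor product is a quotient of a free module, both
  statements reduce to the corresponding ones for free modules and for quotients.\<close>

section \<open>Free modules\<close>

context cring
begin

lemma finite_support_submodule:
  "submodule R {u \<in> S \<rightarrow>\<^sub>E carrier R. finite {s \<in> S. u s \<noteq> \<zero>}} (func_space S)"
proof -
  interpret F: module R "func_space S"
    by (rule func_space_is_module)
  let ?W = "{u \<in> S \<rightarrow>\<^sub>E carrier R. finite {s \<in> S. u s \<noteq> \<zero>}}"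
  show ?thesis
  proof (rule submodule.intro)
    fix u v
    assume uv: "u \<in> ?W" "v \<in> ?W"
    have "{s \<in> S. (\<lambda>s\<in>S. u s \<oplus> v s) s \<noteq> \<zero>} \<subseteq> {s \<in> S. u s \<noteq> \<zero>} \<union> {s \<in> S. v s \<noteq> \<zero>}"
      by auto
    then have "finite {s \<in> S. (\<lambda>s\<in>S. u s \<oplus> v s) s \<noteq> \<zero>}"
      by (rule finite_subset) (use uv in auto)
    moreover have "(\<lambda>s\<in>S. u s \<oplus> v s) \<in> S \<rightarrow>\<^sub>E carrier R"
      using uv by auto
    ultimately show "u \<oplus>\<^bsub>func_space S\<^esub> v \<in> ?W"
      by (simp add: func_space_def)
  next
    fix c u
    assume c: "c \<in> carrier R" and u: "u \<in> ?W"
    have "{s \<in> S. (\<lambda>s\<in>S. c \<otimes> u s) s \<noteq> \<zero>} \<subseteq> {s \<in> S. u s \<noteq> \<zero>}"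
      using c by auto
    then have "finite {s \<in> S. (\<lambda>s\<in>S. c \<otimes> u s) s \<noteq> \<zero>}"
      by (rule finite_subset) (use u in auto)
    moreover have "(\<lambda>s\<in>S. c \<otimes> u s) \<in> S \<rightarrow>\<^sub>E carrier R"
      using c u by auto
    ultimately show "c \<odot>\<^bsub>func_space S\<^esub> u \<in> ?W"
      by (simp add: func_space_def)
  next
    show "module R (func_space S)" by (rule F.module_axioms)
  qed (auto simp: func_space_def)
qed

lemma free_space_module: "module R (free_space R S)"
proof -
  interpret F: module R "func_space S"
    by (rule func_space_is_module)
  show ?thesis
    unfolding free_space_def by (rule F.submodule_is_module[OF finite_support_submodule])
qed

lemma free_space_simps:
  "carrier (free_space R S) = {u \<in> S \<rightarrow>\<^sub>E carrier R. finite {s \<in> S. u s \<noteq> \<zero>}}"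
  "u \<oplus>\<^bsub>free_space R S\<^esub> v = (\<lambda>s\<in>S. u s \<oplus> v s)"
  "c \<odot>\<^bsub>free_space R S\<^esub> u = (\<lambda>s\<in>S. c \<otimes> u s)"
  "\<zero>\<^bsub>free_space R S\<^esub> = (\<lambda>s\<in>S. \<zero>)"
  by (simp_all add: free_space_def func_space_def)

lemma free_gen_closed: "s \<in> S \<Longrightarrow> free_gen R S s \<in> carrier (free_space R S)"
  by (auto simp: free_space_simps free_gen_def intro!: finite_subset[of _ "{s}"])

text \<open>The generators span the free module: subtracting \<open>u a\<close> times the generator of \<open>a\<close> removes
  \<open>a\<close> from the support of \<open>u\<close>, so induction on the size of the support applies.\<close>

lemma free_space_eqI:
  assumes N: "submodule R N (free_space R S)" and gen: "\<And>s. s \<in> S \<Longrightarrow> free_gen R S s \<in> N"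
  shows "N = carrier (free_space R S)"
proof -
  interpret N: submodule R N "free_space R S" by (rule N)
  \<comment> \<open>The support is only bounded by \<open>A\<close>, so that shrinking \<open>A\<close> fits the induction.\<close>
  have "u \<in> N"
    if "finite A" and "u \<in> S \<rightarrow>\<^sub>E carrier R" and "{s \<in> S. u s \<noteq> \<zero>} \<subseteq> A" for A u
    using that
  proof (induction A arbitrary: u rule: finite_induct)
    case empty
    then have "u = \<zero>\<^bsub>free_space R S\<^esub>"
      by (auto simp: free_space_simps fun_eq_iff PiE_def extensional_def)
    then show ?case by simp
  next
    case (insert a A)
    show ?case
    proof (cases "a \<in> S")
      case False
      with insert show ?thesis by auto
    next
      case True
      let ?v = "u(a := \<zero>)"
      have "?v \<in> N"
        using insert.prems True by (intro insert.IH) (auto simp: PiE_def extensional_def)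
      moreover have "u a \<odot>\<^bsub>free_space R S\<^esub> free_gen R S a \<in> N"
        using insert.prems True gen by auto
      moreover have "u = ?v \<oplus>\<^bsub>free_space R S\<^esub> u a \<odot>\<^bsub>free_space R S\<^esub> free_gen R S a"
        using insert.prems True
        by (auto simp: free_space_simps free_gen_def fun_eq_iff PiE_def extensional_def Pi_def)
      ultimately show ?thesis by (metis N.m_closed)
    qed
  qed
  then have "carrier (free_space R S) \<subseteq> N"
    by (auto simp: free_space_simps)
  with N.subset show ?thesis by blast
qed

end

text \<open>The linear extension of \<open>f\<close> from the generators. Summing over the support alone keeps the sum
  finite even when \<open>S\<close> is infinite.\<close>

definition free_lift ::
  "('k, 'r) ring_scheme \<Rightarrow> 's set \<Rightarrow> ('k, 'p, 'e) module_scheme \<Rightarrow> ('s \<Rightarrow> 'p) \<Rightarrow> ('s \<Rightarrow> 'k) \<Rightarrow> 'p"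
  where "free_lift k S P f u = (\<Oplus>\<^bsub>P\<^esub>s\<in>{s \<in> S. u s \<noteq> \<zero>\<^bsub>k\<^esub>}. u s \<odot>\<^bsub>P\<^esub> f s)"

context module
begin

text \<open>Vectors with different supports can be compared only after enlarging the index sets to a common
  one, which is harmless because the additional coefficients vanish.\<close>

lemma free_lift_eq_finsum:
  assumes "finite A" and "{s \<in> S. u s \<noteq> \<zero>} \<subseteq> A" and "A \<subseteq> S"
    and "u \<in> S \<rightarrow> carrier R" and "f \<in> S \<rightarrow> carrier M"
  shows "free_lift R S M f u = (\<Oplus>\<^bsub>M\<^esub>s\<in>A. u s \<odot>\<^bsub>M\<^esub> f s)"
  unfolding free_lift_def
proof (rule M.add.finprod_mono_neutral_cong_left)
  show "\<And>i. i \<in> A - {s \<in> S. u s \<noteq> \<zero>} \<Longrightarrow> u i \<odot>\<^bsub>M\<^esub> f i = \<zero>\<^bsub>M\<^esub>"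
    using assms by (auto simp: Pi_def subset_iff)
qed (use assms in \<open>auto simp: Pi_def subset_iff\<close>)

lemma free_lift_hom:
  assumes f: "f \<in> S \<rightarrow> carrier M"
  shows "free_lift R S M f \<in> module_hom R (free_space R S) M"
  unfolding module_hom_def mem_Collect_eq
proof (intro conjI allI impI)
  show "free_lift R S M f \<in> carrier (free_space R S) \<rightarrow> carrier M"
    using f by (auto simp: free_lift_def R.free_space_simps PiE_def Pi_iff intro!: M.finsum_closed)
next
  fix u v
  assume "u \<in> carrier (free_space R S) \<and> v \<in> carrier (free_space R S)"
  then have u: "u \<in> S \<rightarrow> carrier R" "finite {s \<in> S. u s \<noteq> \<zero>}"
    and v: "v \<in> S \<rightarrow> carrier R" "finite {s \<in> S. v s \<noteq> \<zero>}"
    by (auto simp: R.free_space_simps PiE_def)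
  let ?A = "{s \<in> S. u s \<noteq> \<zero>} \<union> {s \<in> S. v s \<noteq> \<zero>}"
  have "free_lift R S M f (u \<oplus>\<^bsub>free_space R S\<^esub> v) =
      (\<Oplus>\<^bsub>M\<^esub>s\<in>?A. (u \<oplus>\<^bsub>free_space R S\<^esub> v) s \<odot>\<^bsub>M\<^esub> f s)"
    using u v f by (intro free_lift_eq_finsum) (auto simp: R.free_space_simps Pi_def)
  also have "\<dots> = (\<Oplus>\<^bsub>M\<^esub>s\<in>?A. u s \<odot>\<^bsub>M\<^esub> f s \<oplus>\<^bsub>M\<^esub> v s \<odot>\<^bsub>M\<^esub> f s)"
    using u v f
    by (intro M.finsum_cong') (auto simp: R.free_space_simps smult_l_distr Pi_def)
  also have "\<dots> = (\<Oplus>\<^bsub>M\<^esub>s\<in>?A. u s \<odot>\<^bsub>M\<^esub> f s) \<oplus>\<^bsub>M\<^esub> (\<Oplus>\<^bsub>M\<^esub>s\<in>?A. v s \<odot>\<^bsub>M\<^esub> f s)"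
    using u v f by (intro M.finsum_addf) (auto simp: Pi_def)
  also have "(\<Oplus>\<^bsub>M\<^esub>s\<in>?A. u s \<odot>\<^bsub>M\<^esub> f s) = free_lift R S M f u"
    using u v f by (intro free_lift_eq_finsum[symmetric]) auto
  also have "(\<Oplus>\<^bsub>M\<^esub>s\<in>?A. v s \<odot>\<^bsub>M\<^esub> f s) = free_lift R S M f v"
    using u v f by (intro free_lift_eq_finsum[symmetric]) auto
  finally show "free_lift R S M f (u \<oplus>\<^bsub>free_space R S\<^esub> v) =
      free_lift R S M f u \<oplus>\<^bsub>M\<^esub> free_lift R S M f v" .
next
  fix c u
  assume "c \<in> carrier R \<and> u \<in> carrier (free_space R S)"
  then have c: "c \<in> carrier R" and u: "u \<in> S \<rightarrow> carrier R" "finite {s \<in> S. u s \<noteq> \<zero>}"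
    by (auto simp: R.free_space_simps PiE_def)
  let ?A = "{s \<in> S. u s \<noteq> \<zero>}"
  have "free_lift R S M f (c \<odot>\<^bsub>free_space R S\<^esub> u) =
      (\<Oplus>\<^bsub>M\<^esub>s\<in>?A. (c \<odot>\<^bsub>free_space R S\<^esub> u) s \<odot>\<^bsub>M\<^esub> f s)"
    using c u f by (intro free_lift_eq_finsum) (auto simp: R.free_space_simps Pi_def)
  also have "\<dots> = (\<Oplus>\<^bsub>M\<^esub>s\<in>?A. c \<odot>\<^bsub>M\<^esub> (u s \<odot>\<^bsub>M\<^esub> f s))"
    using c u f
    by (intro M.finsum_cong') (auto simp: R.free_space_simps smult_assoc1 Pi_def)
  also have "\<dots> = c \<odot>\<^bsub>M\<^esub> free_lift R S M f u"
    unfolding free_lift_def using c u f by (intro finsum_smult[symmetric]) (auto simp: Pi_def)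
  finally show "free_lift R S M f (c \<odot>\<^bsub>free_space R S\<^esub> u) = c \<odot>\<^bsub>M\<^esub> free_lift R S M f u" .
qed

lemma free_lift_gen:
  assumes f: "f \<in> S \<rightarrow> carrier M" and s: "s \<in> S"
  shows "free_lift R S M f (free_gen R S s) = f s"
proof -
  have "free_lift R S M f (free_gen R S s) = (\<Oplus>\<^bsub>M\<^esub>t\<in>{s}. free_gen R S s t \<odot>\<^bsub>M\<^esub> f t)"
    using f s by (intro free_lift_eq_finsum) (auto simp: free_gen_def)
  also have "\<dots> = f s"
    using f s by (simp add: free_gen_def Pi_iff)
  finally show ?thesis .
qed

end

section \<open>Quotient modules\<close>

locale quotient_module =
  V?: module k V + W?: submodule k W V for k and V (structure) and W
begin

sublocale abelian_subgroup W V
proof (rule abelian_subgroupI3)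
  \<comment> \<open>Closure under negation is closure under multiplication by \<open>- 1\<close>.\<close>
  have "\<ominus>\<^bsub>V\<^esub> x \<in> W" if "x \<in> W" for x
    using W.smult_closed[of "\<ominus>\<^bsub>k\<^esub> \<one>\<^bsub>k\<^esub>" x] that W.subset V.smult_minus_1[of x]
    by (metis V.R.add.inv_closed V.R.one_closed subsetD)
  moreover have "W \<noteq> {}"
    using W.zero_closed by blast
  ultimately show "additive_subgroup W V"
    using subset by (intro additive_subgroupI V.M.add.subgroupI) (auto simp flip: a_inv_def)
  show "abelian_group V" by (rule V.M.abelian_group_axioms)
qed

abbreviation Q where "Q \<equiv> quotient_space V W"

lemma quotient_carrierE:
  assumes "X \<in> carrier Q"
  obtains x where "x \<in> carrier V" and "X = W +> x"
  using assms by (auto simp: quotient_space_def A_RCOSETS_def')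

lemma coset_closed: "x \<in> carrier V \<Longrightarrow> W +> x \<in> carrier Q"
  by (auto simp: quotient_space_def A_RCOSETS_def')

lemma coset_add:
  assumes "x \<in> carrier V" and "y \<in> carrier V"
  shows "(W +> x) \<oplus>\<^bsub>Q\<^esub> (W +> y) = W +> (x \<oplus> y)"
  using assms by (simp add: quotient_space_def a_rcos_sum)

lemma coset_eqI:
  assumes "x \<in> carrier V" and "y \<in> carrier V" and "x \<ominus> y \<in> W"
  shows "W +> x = W +> y"
proof -
  have "x = (x \<ominus> y) \<oplus> y"
    using assms by (simp add: a_minus_def V.M.a_assoc V.M.l_neg)
  then have "x \<in> W +> y"
    using assms(3) by (auto simp: a_r_coset_def')
  then show ?thesis
    using assms(2) by (intro a_repr_independence'[symmetric])
qed

text \<open>Multiplication in the quotient is a union over all representatives of the coset. All of them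
  contribute the same coset because \<open>W\<close> is stable under scalars.\<close>

lemma coset_smult:
  assumes c: "c \<in> carrier k" and x: "x \<in> carrier V"
  shows "c \<odot>\<^bsub>Q\<^esub> (W +> x) = W +> c \<odot> x"
proof -
  have "W +> c \<odot> y = W +> c \<odot> x" if y: "y \<in> W +> x" for y
  proof -
    obtain w where w: "w \<in> W" "y = w \<oplus> x"
      using y by (auto simp: a_r_coset_def')
    then have "c \<odot> y = c \<odot> w \<oplus> c \<odot> x"
      using c x by (auto simp: V.smult_r_distr)
    then have "c \<odot> y \<in> W +> c \<odot> x"
      using c w by (auto simp: a_r_coset_def')
    then show ?thesis
      using c x by (intro a_repr_independence'[symmetric]) auto
  qed
  then have "(\<Union>y\<in>W +> x. W +> c \<odot> y) = W +> c \<odot> x"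
    using a_rcos_self[OF x] by blast
  then show ?thesis
    by (simp add: quotient_space_def)
qed

lemma coset_zero: "\<zero>\<^bsub>Q\<^esub> = W +> \<zero>"
  using a_subset by (simp add: quotient_space_def)

lemma quotient_space_module: "module k Q"
proof (rule moduleI)
  show "cring k" by (rule V.R.cring_axioms)
  show "abelian_group Q"
  proof (rule abelian_groupI)
    fix X assume "X \<in> carrier Q"
    then obtain x where "x \<in> carrier V" and "X = W +> x" by (rule quotient_carrierE)
    then show "\<exists>Y\<in>carrier Q. Y \<oplus>\<^bsub>Q\<^esub> X = \<zero>\<^bsub>Q\<^esub>"
      by (intro bexI[of _ "W +> (\<ominus> x)"]) (simp_all add: coset_add coset_zero V.M.l_neg coset_closed)
  next
    fix X Y assume "X \<in> carrier Q" and "Y \<in> carrier Q"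
    then show "X \<oplus>\<^bsub>Q\<^esub> Y = Y \<oplus>\<^bsub>Q\<^esub> X"
      by (elim quotient_carrierE) (simp add: coset_add V.M.a_comm)
  qed ((elim quotient_carrierE)?, simp add: coset_add coset_zero coset_closed V.M.a_assoc)+
qed ((elim quotient_carrierE)?, simp add: coset_add coset_smult coset_closed
      V.smult_assoc1 V.smult_l_distr V.smult_r_distr)+

lemma quotient_lift:
  assumes P: "module k P" and h: "h \<in> module_hom k V P" and ker: "\<And>x. x \<in> W \<Longrightarrow> h x = \<zero>\<^bsub>P\<^esub>"
  obtains g where "g \<in> module_hom k Q P" and "\<And>x. x \<in> carrier V \<Longrightarrow> g (W +> x) = h x"
proof -
  interpret P: module k P by (rule P)
  have inv: "h y = h x" if "x \<in> carrier V" "y \<in> W +> x" for x y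
  proof -
    obtain w where "w \<in> W" "y = w \<oplus> x"
      using \<open>y \<in> W +> x\<close> by (auto simp: a_r_coset_def')
    then show ?thesis
      using ker h subset \<open>x \<in> carrier V\<close>
      by (auto simp: module_hom_def Pi_iff subset_iff)
  qed
  \<comment> \<open>The fact \<open>inv\<close> makes the choice of a representative immaterial.\<close>
  define g where "g X = h (SOME x. x \<in> X)" for X
  have g: "g (W +> x) = h x" if "x \<in> carrier V" for x
    unfolding g_def by (rule inv[OF that someI]) (rule a_rcos_self[OF that])
  have "g \<in> module_hom k Q P"
    using h by (auto simp: module_hom_def Pi_iff coset_add coset_smult g elim!: quotient_carrierE)
  with g show thesis by (rule that[rotated])
qed

end


section \<open>Tensor products\<close>

text \<open>Linearity of all partial maps, phrased with \<open>module_hom\<close> so that closure properties of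
  bilinear maps follow from those of linear maps in each variable.\<close>

definition bilinear ::
  "('k, 'r) ring_scheme \<Rightarrow> ('k, 'm, 'e) module_scheme \<Rightarrow> ('k, 'n, 'f) module_scheme
    \<Rightarrow> ('k, 'p, 'g) module_scheme \<Rightarrow> ('m \<Rightarrow> 'n \<Rightarrow> 'p) \<Rightarrow> bool"
  where "bilinear k M N P f \<longleftrightarrow>
    (\<forall>x\<in>carrier M. f x \<in> module_hom k N P) \<and> (\<forall>y\<in>carrier N. (\<lambda>x. f x y) \<in> module_hom k M P)"

lemma bilinearD:
  assumes "bilinear k M N P f" and "x \<in> carrier M" and "y \<in> carrier N"
  shows bilinear_closed: "f x y \<in> carrier P"
    and bilinear_add_left: "x' \<in> carrier M \<Longrightarrow> f (x \<oplus>\<^bsub>M\<^esub> x') y = f x y \<oplus>\<^bsub>P\<^esub> f x' y"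
    and bilinear_add_right: "y' \<in> carrier N \<Longrightarrow> f x (y \<oplus>\<^bsub>N\<^esub> y') = f x y \<oplus>\<^bsub>P\<^esub> f x y'"
    and bilinear_smult_left: "c \<in> carrier k \<Longrightarrow> f (c \<odot>\<^bsub>M\<^esub> x) y = c \<odot>\<^bsub>P\<^esub> f x y"
    and bilinear_smult_right: "c \<in> carrier k \<Longrightarrow> f x (c \<odot>\<^bsub>N\<^esub> y) = c \<odot>\<^bsub>P\<^esub> f x y"
  using assms by (auto simp: bilinear_def module_hom_def Pi_iff)

lemma bilinear_swap: "bilinear k M N P f \<Longrightarrow> bilinear k N M P (\<lambda>y x. f x y)"
  by (simp add: bilinear_def)

lemma bilinear_compose:
  assumes "bilinear k M N P f" and "g \<in> module_hom k M' M" and "h \<in> module_hom k N' N"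
  shows "bilinear k M' N' P (\<lambda>x y. f (g x) (h y))"
  using assms by (simp add: bilinear_def module_hom_def Pi_iff)

lemma (in module) smult_bilinear:
  assumes "g \<in> module_hom R V (field_space R)" and "h \<in> module_hom R W M"
  shows "bilinear R V W M (\<lambda>x y. g x \<odot>\<^bsub>M\<^esub> h y)"
  using assms
  by (simp add: bilinear_def module_hom_def field_space_def Pi_iff smult_l_distr smult_r_distr
      smult_assoc_simp R.m_comm)

lemma (in module) bilinear_smult:
  assumes "c \<in> carrier R" and "bilinear R V W M f"
  shows "bilinear R V W M (\<lambda>x y. c \<odot>\<^bsub>M\<^esub> f x y)"
  using assms
  by (simp add: bilinear_def module_hom_def Pi_iff smult_r_distr smult_assoc_simp R.m_comm)

lemma (in module) bilinear_add:
  assumes "bilinear R V W M f" and "bilinear R V W M g"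
  shows "bilinear R V W M (\<lambda>x y. f x y \<oplus>\<^bsub>M\<^esub> g x y)"
  using assms by (simp add: bilinear_def module_hom_def Pi_iff smult_r_distr M.a_ac)

lemma (in module) bilinear_diff:
  assumes "bilinear R V W M f" and "bilinear R V W M g"
  shows "bilinear R V W M (\<lambda>x y. f x y \<ominus>\<^bsub>M\<^esub> g x y)"
  using assms
  by (simp add: bilinear_def module_hom_def Pi_iff a_minus_def smult_r_distr smult_r_minus
      M.minus_add M.a_ac)

lemma mod_homI:
  assumes "module k M" "module k N" and "f \<in> module_hom k M N"
  shows "mod_hom k M N f"
  using assms by (simp add: mod_hom_def mod_hom_axioms_def)

locale tensor_modules = M: module k M + N: module k N for k and M and N
begin

abbreviation F where "F \<equiv> free_space k (carrier M \<times> carrier N)"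
abbreviation gen where "gen \<equiv> free_gen k (carrier M \<times> carrier N)"
abbreviation W where "W \<equiv> tensor_null k M N"
abbreviation T where "T \<equiv> tensor_space k M N"
abbreviation pure (infixl "\<otimes>\<^sub>t" 75) where "x \<otimes>\<^sub>t y \<equiv> tensor k M N x y"

sublocale F: module k F
  by (rule M.R.free_space_module)

lemma relators_closed: "tensor_relators k M N \<subseteq> carrier F"
  by (auto simp: tensor_relators_def Let_def M.R.free_gen_closed intro!: F.M.minus_closed)

sublocale quotient: quotient_module k F W
  unfolding quotient_module_def tensor_null_def
  by (intro conjI F.module_axioms F.span_is_submodule relators_closed)

text \<open>Each defining relator is a difference of two vectors that are to become equal, which yields the
  four laws of bilinearity below.\<close>

lemma relator_coset_eq:
  assumes "u \<ominus>\<^bsub>F\<^esub> v \<in> tensor_relators k M N" and "u \<in> carrier F" and "v \<in> carrier F"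
  shows "W +>\<^bsub>F\<^esub> u = W +>\<^bsub>F\<^esub> v"
  using assms F.in_own_span[OF relators_closed]
  by (intro quotient.coset_eqI) (auto simp: tensor_null_def)

sublocale T: module k T
  unfolding tensor_space_def by (rule quotient.quotient_space_module)

lemma tensor_closed: "x \<in> carrier M \<Longrightarrow> y \<in> carrier N \<Longrightarrow> x \<otimes>\<^sub>t y \<in> carrier T"
  by (simp add: tensor_def tensor_space_def quotient.coset_closed M.R.free_gen_closed)

lemma tensor_add_left:
  assumes "x \<in> carrier M" and "x' \<in> carrier M" and "y \<in> carrier N"
  shows "(x \<oplus>\<^bsub>M\<^esub> x') \<otimes>\<^sub>t y = x \<otimes>\<^sub>t y \<oplus>\<^bsub>T\<^esub> x' \<otimes>\<^sub>t y"
proof -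
  have "W +>\<^bsub>F\<^esub> gen (x \<oplus>\<^bsub>M\<^esub> x', y) = W +>\<^bsub>F\<^esub> (gen (x, y) \<oplus>\<^bsub>F\<^esub> gen (x', y))"
  proof (rule relator_coset_eq)
    show "gen (x \<oplus>\<^bsub>M\<^esub> x', y) \<ominus>\<^bsub>F\<^esub> (gen (x, y) \<oplus>\<^bsub>F\<^esub> gen (x', y)) \<in> tensor_relators k M N"
      using assms unfolding tensor_relators_def Let_def by blast
  qed (use assms in \<open>simp_all add: M.R.free_gen_closed\<close>)
  then show ?thesis
    using assms by (simp add: tensor_def tensor_space_def quotient.coset_add M.R.free_gen_closed)
qed

lemma tensor_add_right:
  assumes "x \<in> carrier M" and "y \<in> carrier N" and "y' \<in> carrier N"
  shows "x \<otimes>\<^sub>t (y \<oplus>\<^bsub>N\<^esub> y') = x \<otimes>\<^sub>t y \<oplus>\<^bsub>T\<^esub> x \<otimes>\<^sub>t y'"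
proof -
  have "W +>\<^bsub>F\<^esub> gen (x, y \<oplus>\<^bsub>N\<^esub> y') = W +>\<^bsub>F\<^esub> (gen (x, y) \<oplus>\<^bsub>F\<^esub> gen (x, y'))"
  proof (rule relator_coset_eq)
    show "gen (x, y \<oplus>\<^bsub>N\<^esub> y') \<ominus>\<^bsub>F\<^esub> (gen (x, y) \<oplus>\<^bsub>F\<^esub> gen (x, y')) \<in> tensor_relators k M N"
      using assms unfolding tensor_relators_def Let_def by blast
  qed (use assms in \<open>simp_all add: M.R.free_gen_closed\<close>)
  then show ?thesis
    using assms by (simp add: tensor_def tensor_space_def quotient.coset_add M.R.free_gen_closed)
qed

lemma tensor_smult_left:
  assumes "c \<in> carrier k" and "x \<in> carrier M" and "y \<in> carrier N"
  shows "(c \<odot>\<^bsub>M\<^esub> x) \<otimes>\<^sub>t y = c \<odot>\<^bsub>T\<^esub> (x \<otimes>\<^sub>t y)"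
proof -
  have "W +>\<^bsub>F\<^esub> gen (c \<odot>\<^bsub>M\<^esub> x, y) = W +>\<^bsub>F\<^esub> c \<odot>\<^bsub>F\<^esub> gen (x, y)"
  proof (rule relator_coset_eq)
    show "gen (c \<odot>\<^bsub>M\<^esub> x, y) \<ominus>\<^bsub>F\<^esub> c \<odot>\<^bsub>F\<^esub> gen (x, y) \<in> tensor_relators k M N"
      using assms unfolding tensor_relators_def Let_def by blast
  qed (use assms in \<open>simp_all add: M.R.free_gen_closed\<close>)
  then show ?thesis
    using assms by (simp add: tensor_def tensor_space_def quotient.coset_smult M.R.free_gen_closed)
qed

lemma tensor_smult_right:
  assumes "c \<in> carrier k" and "x \<in> carrier M" and "y \<in> carrier N"
  shows "x \<otimes>\<^sub>t (c \<odot>\<^bsub>N\<^esub> y) = c \<odot>\<^bsub>T\<^esub> (x \<otimes>\<^sub>t y)"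
proof -
  have "W +>\<^bsub>F\<^esub> gen (x, c \<odot>\<^bsub>N\<^esub> y) = W +>\<^bsub>F\<^esub> c \<odot>\<^bsub>F\<^esub> gen (x, y)"
  proof (rule relator_coset_eq)
    show "gen (x, c \<odot>\<^bsub>N\<^esub> y) \<ominus>\<^bsub>F\<^esub> c \<odot>\<^bsub>F\<^esub> gen (x, y) \<in> tensor_relators k M N"
      using assms unfolding tensor_relators_def Let_def by blast
  qed (use assms in \<open>simp_all add: M.R.free_gen_closed\<close>)
  then show ?thesis
    using assms by (simp add: tensor_def tensor_space_def quotient.coset_smult M.R.free_gen_closed)
qed

lemma tensor_bilinear: "bilinear k M N T (\<otimes>\<^sub>t)"
  by (simp add: bilinear_def module_hom_def tensor_closed tensor_add_left tensor_add_right
      tensor_smult_left tensor_smult_right)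

text \<open>The vectors of the free module whose coset satisfies \<open>P\<close> form a submodule containing all
  generators, hence they are all of it. There is no separate case for zero because
  \<open>0 = 0 (0 \<otimes> 0)\<close> is a multiple of a pure tensor.\<close>

lemma tensor_space_induct [consumes 1, case_names tensor add smult]:
  assumes t: "t \<in> carrier T"
    and tensor: "\<And>x y. x \<in> carrier M \<Longrightarrow> y \<in> carrier N \<Longrightarrow> P (x \<otimes>\<^sub>t y)"
    and add: "\<And>s t. s \<in> carrier T \<Longrightarrow> P s \<Longrightarrow> t \<in> carrier T \<Longrightarrow> P t \<Longrightarrow> P (s \<oplus>\<^bsub>T\<^esub> t)"
    and smult: "\<And>c t. c \<in> carrier k \<Longrightarrow> t \<in> carrier T \<Longrightarrow> P t \<Longrightarrow> P (c \<odot>\<^bsub>T\<^esub> t)"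
  shows "P t"
proof -
  let ?U = "{u \<in> carrier F. P (W +>\<^bsub>F\<^esub> u)}"
  have "P (\<zero>\<^bsub>k\<^esub> \<odot>\<^bsub>T\<^esub> (\<zero>\<^bsub>M\<^esub> \<otimes>\<^sub>t \<zero>\<^bsub>N\<^esub>))"
    by (intro smult tensor tensor_closed) auto
  then have "P (W +>\<^bsub>F\<^esub> \<zero>\<^bsub>F\<^esub>)"
    using T.lmult_0[OF tensor_closed[of "\<zero>\<^bsub>M\<^esub>" "\<zero>\<^bsub>N\<^esub>"]] quotient.coset_zero
    by (simp add: tensor_space_def)
  moreover have "P (W +>\<^bsub>F\<^esub> (u \<oplus>\<^bsub>F\<^esub> v))" if "u \<in> ?U" "v \<in> ?U" for u v
    using add[of "W +>\<^bsub>F\<^esub> u" "W +>\<^bsub>F\<^esub> v"] that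
    by (simp add: tensor_space_def quotient.coset_closed quotient.coset_add)
  moreover have "P (W +>\<^bsub>F\<^esub> (c \<odot>\<^bsub>F\<^esub> u))" if "c \<in> carrier k" "u \<in> ?U" for c u
    using smult[of c "W +>\<^bsub>F\<^esub> u"] that
    by (simp add: tensor_space_def quotient.coset_closed quotient.coset_smult)
  ultimately have "submodule k ?U F"
    by (intro submodule.intro F.module_axioms) auto
  then have "?U = carrier F"
    by (rule M.R.free_space_eqI)
      (use tensor in \<open>auto simp: tensor_def M.R.free_gen_closed\<close>)
  moreover obtain u where "u \<in> carrier F" and "t = W +>\<^bsub>F\<^esub> u"
    using t unfolding tensor_space_def by (rule quotient.quotient_carrierE)
  ultimately show ?thesis by blast
qed

text \<open>The linear extension of \<open>f\<close> to the free module on \<open>M \<times> N\<close> kills the relators exactly because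
  \<open>f\<close> is bilinear. Its kernel is a submodule, so it contains their span, and the extension factors
  through the quotient.\<close>

lemma tensor_lift_exists:
  assumes P: "module k P" and f: "bilinear k M N P f"
  obtains h where "h \<in> module_hom k T P"
    and "\<And>x y. x \<in> carrier M \<Longrightarrow> y \<in> carrier N \<Longrightarrow> h (x \<otimes>\<^sub>t y) = f x y"
proof -
  interpret P: module k P by (rule P)
  let ?S = "carrier M \<times> carrier N" and ?f = "\<lambda>(x, y). f x y"
  let ?L = "free_lift k ?S P ?f"
  have fS: "?f \<in> ?S \<rightarrow> carrier P"
    using bilinear_closed[OF f] by auto
  interpret L: mod_hom k F P ?L
    using P.free_lift_hom[OF fS] by (intro mod_homI F.module_axioms P)
  have gen: "?L (gen (x, y)) = f x y" if "x \<in> carrier M" "y \<in> carrier N" for x y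
    using P.free_lift_gen[OF fS, of "(x, y)"] that by simp
  have "tensor_relators k M N \<subseteq> L.ker"
    using relators_closed unfolding tensor_relators_def Let_def L.ker_def
    by (auto simp: gen M.R.free_gen_closed bilinear_closed[OF f] bilinear_add_left[OF f]
        bilinear_add_right[OF f] bilinear_smult_left[OF f] bilinear_smult_right[OF f])
  then have "W \<subseteq> L.ker"
    unfolding tensor_null_def by (rule F.span_is_subset[OF _ L.ker_is_submodule])
  then obtain h where "h \<in> module_hom k T P"
    and "\<And>u. u \<in> carrier F \<Longrightarrow> h (W +>\<^bsub>F\<^esub> u) = ?L u"
    unfolding tensor_space_def using quotient.quotient_lift[OF P L.f_hom] L.f_ker by blast
  with gen show thesis
    by (intro that[of h]) (auto simp: tensor_def M.R.free_gen_closed)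
qed

end

lemma linear_mapI:
  assumes "field k" and "module k M" and "module k N" and "f \<in> module_hom k M N"
  shows "linear_map k M N f"
  using assms by (simp add: linear_map_def vectorspace_def mod_homI)

locale tensor_vectorspaces = M: vectorspace k M + N: vectorspace k N for k and M and N
begin

sublocale tensor_modules k M N ..

text \<open>The description that defines \<open>tensor_lift\<close> is satisfied by exactly one map: by a restriction of
  the map of \<open>tensor_lift_exists\<close>, and by no other since linear maps that agree on pure
  tensors agree on the whole space.\<close>

lemma tensor_lift:
  assumes P: "module k P" and f: "bilinear k M N P f"
  shows tensor_lift_linear: "linear_map k T P (tensor_lift k M N P f)"
    and tensor_lift_tensor: "x \<in> carrier M \<Longrightarrow> y \<in> carrier N \<Longrightarrow>
      tensor_lift k M N P f (x \<otimes>\<^sub>t y) = f x y"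
proof -
  let ?lifts = "\<lambda>h. h \<in> extensional (carrier T) \<and> linear_map k T P h
      \<and> (\<forall>x\<in>carrier M. \<forall>y\<in>carrier N. h (x \<otimes>\<^sub>t y) = f x y)"
  obtain h where h: "h \<in> module_hom k T P"
    and h_tensor: "\<And>x y. x \<in> carrier M \<Longrightarrow> y \<in> carrier N \<Longrightarrow> h (x \<otimes>\<^sub>t y) = f x y"
    using tensor_lift_exists[OF P f] by blast
  have "restrict h (carrier T) \<in> module_hom k T P"
    using h by (simp add: module_hom_def Pi_iff)
  then have "linear_map k T P (restrict h (carrier T))"
    by (intro linear_mapI P T.module_axioms M.field_axioms)
  then have "?lifts (restrict h (carrier T))"
    using h_tensor by (simp add: tensor_closed)
  moreover have "g = g'" if "?lifts g" and "?lifts g'" for g g'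
  proof -
    interpret g: linear_map k T P g using that by blast
    interpret g': linear_map k T P g' using that by blast
    have "g t = g' t" if "t \<in> carrier T" for t
      using that
      by (induction rule: tensor_space_induct)
        (use \<open>?lifts g\<close> \<open>?lifts g'\<close> in \<open>auto\<close>)
    then show ?thesis
      using that by (blast intro: extensionalityI)
  qed
  ultimately have "\<exists>!h. ?lifts h" by blast
  from theI'[OF this] have "?lifts (tensor_lift k M N P f)"
    unfolding tensor_lift_def .
  then show "linear_map k T P (tensor_lift k M N P f)"
    and "x \<in> carrier M \<Longrightarrow> y \<in> carrier N \<Longrightarrow> tensor_lift k M N P f (x \<otimes>\<^sub>t y) = f x y"
    by auto
qed

end


section \<open>The braid operators of a Hom-coalgebra\<close>

context hom_coalgebra
begin

sublocale CC: tensor_vectorspaces k C C ..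

abbreviation T where "T \<equiv> tensor_space k C C"
abbreviation pure (infixl "\<otimes>\<^sub>t" 75) where "x \<otimes>\<^sub>t y \<equiv> tensor k C C x y"

definition braid :: "'a \<Rightarrow> 'a \<Rightarrow> 'a \<Rightarrow> 'c \<Rightarrow> 'c \<Rightarrow> ('c \<times> 'c \<Rightarrow> 'a) set"
  where "braid p q r x y = (p \<otimes>\<^bsub>k\<^esub> \<epsilon> x) \<odot>\<^bsub>T\<^esub> \<Delta> y \<oplus>\<^bsub>T\<^esub> (q \<otimes>\<^bsub>k\<^esub> \<epsilon> y) \<odot>\<^bsub>T\<^esub> \<Delta> x
      \<ominus>\<^bsub>T\<^esub> r \<odot>\<^bsub>T\<^esub> (\<alpha> x \<otimes>\<^sub>t \<alpha> y)"

lemma counit_closed: "x \<in> carrier C \<Longrightarrow> \<epsilon> x \<in> carrier k"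
  using counit.T_im[of x] by (simp add: field_space_def)

lemma scaled_counit_hom:
  assumes "p \<in> carrier k"
  shows "(\<lambda>x. p \<otimes>\<^bsub>k\<^esub> \<epsilon> x) \<in> module_hom k C (field_space k)"
  using assms counit.T_hom
  by (simp add: module_hom_def field_space_def Pi_iff C.module.R.r_distr C.module.R.m_lcomm)

lemma braid_bilinear:
  assumes "p \<in> carrier k" and "q \<in> carrier k" and "r \<in> carrier k"
  shows "bilinear k C C T (braid p q r)"
  unfolding braid_def using assms
  by (intro comul.W.module.bilinear_diff comul.W.module.bilinear_add comul.W.module.bilinear_smult comul.W.module.smult_bilinear
      bilinear_swap[OF comul.W.module.smult_bilinear] bilinear_compose[OF CC.tensor_bilinear]
      scaled_counit_hom comul.T_hom twist.T_hom)

lemma counit_left_bilinear: "bilinear k C C C (\<lambda>a b. \<epsilon> a \<odot>\<^bsub>C\<^esub> b)"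
  by (rule C.module.smult_bilinear[OF counit.T_hom]) (simp add: module_hom_def)

lemma counit_right_bilinear: "bilinear k C C C (\<lambda>a b. \<epsilon> b \<odot>\<^bsub>C\<^esub> a)"
  by (rule bilinear_swap[OF counit_left_bilinear])

text \<open>The map \<open>h\<close> is \<open>p \<Delta> \<circ> (\<epsilon> \<otimes> id) + q \<Delta> \<circ> (id \<otimes> \<epsilon>) - r (\<alpha> \<otimes> \<alpha>)\<close>, as one sees on pure tensors.
  At \<open>\<Delta>(c)\<close> the counit laws turn the first two summands into multiples of \<open>\<Delta>(\<alpha>(c))\<close>, and the last
  one is such a multiple because \<open>\<Delta>\<close> commutes with the twist.\<close>

lemma braid_lift_comul:
  assumes h: "h \<in> module_hom k T T" and pqr: "p \<in> carrier k" "q \<in> carrier k" "r \<in> carrier k"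
    and h_tensor: "\<And>x y. x \<in> carrier C \<Longrightarrow> y \<in> carrier C \<Longrightarrow> h (x \<otimes>\<^sub>t y) = braid p q r x y"
    and c: "c \<in> carrier C"
  shows "h (\<Delta> c) = (p \<oplus>\<^bsub>k\<^esub> q \<ominus>\<^bsub>k\<^esub> r) \<odot>\<^bsub>T\<^esub> \<Delta> (\<alpha> c)"
proof -
  let ?L = "tensor_lift k C C C (\<lambda>a b. \<epsilon> a \<odot>\<^bsub>C\<^esub> b)"
  let ?R = "tensor_lift k C C C (\<lambda>a b. \<epsilon> b \<odot>\<^bsub>C\<^esub> a)"
  let ?A = "tensor_map k C C C C \<alpha> \<alpha>"
  have A_bilinear: "bilinear k C C T (\<lambda>x y. \<alpha> x \<otimes>\<^sub>t \<alpha> y)"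
    by (rule bilinear_compose[OF CC.tensor_bilinear twist.T_hom twist.T_hom])
  interpret h: mod_hom k T T h
    by (intro mod_homI comul.W.module.module_axioms h)
  interpret L: linear_map k T C ?L
    by (rule CC.tensor_lift_linear[OF C.module.module_axioms counit_left_bilinear])
  interpret R: linear_map k T C ?R
    by (rule CC.tensor_lift_linear[OF C.module.module_axioms counit_right_bilinear])
  interpret A: linear_map k T T ?A
    unfolding tensor_map_def by (rule CC.tensor_lift_linear[OF comul.W.module.module_axioms A_bilinear])
  have h_eq: "h t = p \<odot>\<^bsub>T\<^esub> \<Delta> (?L t) \<oplus>\<^bsub>T\<^esub> q \<odot>\<^bsub>T\<^esub> \<Delta> (?R t) \<ominus>\<^bsub>T\<^esub> r \<odot>\<^bsub>T\<^esub> ?A t"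
    if "t \<in> carrier T" for t
    using that
  proof (induction rule: CC.tensor_space_induct)
    case (tensor x y)
    have "?L (x \<otimes>\<^sub>t y) = \<epsilon> x \<odot>\<^bsub>C\<^esub> y" "?R (x \<otimes>\<^sub>t y) = \<epsilon> y \<odot>\<^bsub>C\<^esub> x"
      "?A (x \<otimes>\<^sub>t y) = \<alpha> x \<otimes>\<^sub>t \<alpha> y"
      unfolding tensor_map_def
      using tensor CC.tensor_lift_tensor[OF C.module.module_axioms counit_left_bilinear]
        CC.tensor_lift_tensor[OF C.module.module_axioms counit_right_bilinear]
        CC.tensor_lift_tensor[OF comul.W.module.module_axioms A_bilinear]
      by auto
    then show ?case
      using tensor pqr
      by (simp add: h_tensor braid_def counit_closed comul.T_smult comul.W.module.smult_assoc1)
  next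
    case (add s t)
    then show ?case
      using pqr
      by (simp add: a_minus_def comul.W.module.smult_r_distr comul.W.module.smult_r_minus comul.W.module.M.minus_add comul.W.module.M.a_ac)
  next
    case (smult c t)
    then show ?case
      using pqr
      by (simp add: a_minus_def comul.W.module.smult_r_distr comul.W.module.smult_r_minus comul.W.module.smult_assoc_simp C.module.R.m_comm)
  qed
  have "h (\<Delta> c) = p \<odot>\<^bsub>T\<^esub> \<Delta> (\<alpha> c) \<oplus>\<^bsub>T\<^esub> q \<odot>\<^bsub>T\<^esub> \<Delta> (\<alpha> c) \<ominus>\<^bsub>T\<^esub> r \<odot>\<^bsub>T\<^esub> \<Delta> (\<alpha> c)"
    using c by (simp add: h_eq counit_left counit_right comul_twist)
  also have "\<dots> = (p \<oplus>\<^bsub>k\<^esub> q \<ominus>\<^bsub>k\<^esub> r) \<odot>\<^bsub>T\<^esub> \<Delta> (\<alpha> c)"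
    using c pqr by (simp add: a_minus_def comul.W.module.smult_l_distr comul.W.module.smult_l_minus)
  finally show ?thesis .
qed

text \<open>On a pure tensor, \<open>h'\<close> is applied to two multiples of values of \<open>\<Delta>\<close>, where
  \<open>braid_lift_comul\<close> evaluates it, and to \<open>\<alpha>(x) \<otimes> \<alpha>(y)\<close>, where involutivity returns \<open>x \<otimes> y\<close>
  among other terms. The equations between the scalars are what makes those other terms cancel.\<close>

lemma braid_lift_inverse:
  assumes h: "h \<in> module_hom k T T" and pqr: "p \<in> carrier k" "q \<in> carrier k" "r \<in> carrier k"
    and h_tensor: "\<And>x y. x \<in> carrier C \<Longrightarrow> y \<in> carrier C \<Longrightarrow> h (x \<otimes>\<^sub>t y) = braid p q r x y"
    and h': "h' \<in> module_hom k T T"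
    and pqr': "p' \<in> carrier k" "q' \<in> carrier k" "r' \<in> carrier k"
    and h'_tensor: "\<And>x y. x \<in> carrier C \<Longrightarrow> y \<in> carrier C \<Longrightarrow> h' (x \<otimes>\<^sub>t y) = braid p' q' r' x y"
    and p_eq: "p \<otimes>\<^bsub>k\<^esub> (p' \<oplus>\<^bsub>k\<^esub> q' \<ominus>\<^bsub>k\<^esub> r') = r \<otimes>\<^bsub>k\<^esub> p'"
    and q_eq: "q \<otimes>\<^bsub>k\<^esub> (p' \<oplus>\<^bsub>k\<^esub> q' \<ominus>\<^bsub>k\<^esub> r') = r \<otimes>\<^bsub>k\<^esub> q'"
    and r_eq: "r \<otimes>\<^bsub>k\<^esub> r' = \<one>\<^bsub>k\<^esub>"
    and involutive: "\<And>c. c \<in> carrier C \<Longrightarrow> \<alpha> (\<alpha> c) = c"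
    and t: "t \<in> carrier T"
  shows "h' (h t) = t"
  using t
proof (induction rule: CC.tensor_space_induct)
  case (tensor x y)
  interpret h': mod_hom k T T h'
    by (intro mod_homI comul.W.module.module_axioms h')
  define s where "s = p' \<oplus>\<^bsub>k\<^esub> q' \<ominus>\<^bsub>k\<^esub> r'"
  let ?X = "\<Delta> (\<alpha> y)" and ?Y = "\<Delta> (\<alpha> x)" and ?Z = "x \<otimes>\<^sub>t y"
  have closed: "\<epsilon> x \<in> carrier k" "\<epsilon> y \<in> carrier k" "s \<in> carrier k"
    "?X \<in> carrier T" "?Y \<in> carrier T" "?Z \<in> carrier T"
    "\<alpha> x \<otimes>\<^sub>t \<alpha> y \<in> carrier T"
    using tensor pqr' by (simp_all add: s_def counit_closed CC.tensor_closed)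
  have comul: "h' (\<Delta> c) = s \<odot>\<^bsub>T\<^esub> \<Delta> (\<alpha> c)" if "c \<in> carrier C" for c
    unfolding s_def using h' pqr' h'_tensor that by (rule braid_lift_comul)
  have twist: "h' (\<alpha> x \<otimes>\<^sub>t \<alpha> y) =
      (p' \<otimes>\<^bsub>k\<^esub> \<epsilon> x) \<odot>\<^bsub>T\<^esub> ?X \<oplus>\<^bsub>T\<^esub> (q' \<otimes>\<^bsub>k\<^esub> \<epsilon> y) \<odot>\<^bsub>T\<^esub> ?Y \<ominus>\<^bsub>T\<^esub> r' \<odot>\<^bsub>T\<^esub> ?Z"
    using tensor by (simp add: h'_tensor braid_def counit_twist involutive)
  have scale: "(a \<otimes>\<^bsub>k\<^esub> e) \<otimes>\<^bsub>k\<^esub> s = r \<otimes>\<^bsub>k\<^esub> (a' \<otimes>\<^bsub>k\<^esub> e)"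
    if "a \<otimes>\<^bsub>k\<^esub> s = r \<otimes>\<^bsub>k\<^esub> a'" "a \<in> carrier k" "a' \<in> carrier k" "e \<in> carrier k" for a a' e
  proof -
    have "(a \<otimes>\<^bsub>k\<^esub> e) \<otimes>\<^bsub>k\<^esub> s = (a \<otimes>\<^bsub>k\<^esub> s) \<otimes>\<^bsub>k\<^esub> e"
      using that(2-4) closed by (simp add: C.module.R.m_ac)
    also have "\<dots> = r \<otimes>\<^bsub>k\<^esub> (a' \<otimes>\<^bsub>k\<^esub> e)"
      using that pqr by (simp add: C.module.R.m_assoc)
    finally show ?thesis .
  qed
  have p_eq': "(p \<otimes>\<^bsub>k\<^esub> \<epsilon> x) \<otimes>\<^bsub>k\<^esub> s = r \<otimes>\<^bsub>k\<^esub> (p' \<otimes>\<^bsub>k\<^esub> \<epsilon> x)"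
    and q_eq': "(q \<otimes>\<^bsub>k\<^esub> \<epsilon> y) \<otimes>\<^bsub>k\<^esub> s = r \<otimes>\<^bsub>k\<^esub> (q' \<otimes>\<^bsub>k\<^esub> \<epsilon> y)"
    by (intro scale p_eq[folded s_def] q_eq[folded s_def] pqr pqr' closed)+
  \<comment> \<open>The contribution \<open>U\<close> of the comultiplication terms of \<open>h\<close>; by \<open>p_eq'\<close> and \<open>q_eq'\<close> the
    comultiplication terms of \<open>r h' (\<alpha>(x) \<otimes> \<alpha>(y))\<close> add up to the same \<open>U\<close>.\<close>
  define U where "U = (r \<otimes>\<^bsub>k\<^esub> (p' \<otimes>\<^bsub>k\<^esub> \<epsilon> x)) \<odot>\<^bsub>T\<^esub> ?X \<oplus>\<^bsub>T\<^esub> (r \<otimes>\<^bsub>k\<^esub> (q' \<otimes>\<^bsub>k\<^esub> \<epsilon> y)) \<odot>\<^bsub>T\<^esub> ?Y"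
  have U: "U \<in> carrier T"
    using closed pqr pqr' by (simp add: U_def)
  have "h' (h ?Z) = (p \<otimes>\<^bsub>k\<^esub> \<epsilon> x) \<odot>\<^bsub>T\<^esub> h' (\<Delta> y) \<oplus>\<^bsub>T\<^esub> (q \<otimes>\<^bsub>k\<^esub> \<epsilon> y) \<odot>\<^bsub>T\<^esub> h' (\<Delta> x)
      \<ominus>\<^bsub>T\<^esub> r \<odot>\<^bsub>T\<^esub> h' (\<alpha> x \<otimes>\<^sub>t \<alpha> y)"
    using tensor closed pqr by (simp add: h_tensor braid_def)
  also have "\<dots> = U \<ominus>\<^bsub>T\<^esub> (U \<ominus>\<^bsub>T\<^esub> ?Z)"
    using tensor closed pqr pqr'
    by (simp add: comul twist U_def p_eq' q_eq' r_eq a_minus_def comul.W.module.smult_r_distr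
        comul.W.module.smult_r_minus comul.W.module.smult_assoc_simp)
  also have "\<dots> = ?Z"
    using U closed by (simp add: a_minus_def comul.W.module.M.minus_add comul.W.module.M.r_neg2)
  finally show ?case .
next
  case (add s t)
  then show ?case
    using h h' by (simp add: module_hom_def Pi_iff)
next
  case (smult c t)
  then show ?case
    using h h' by (simp add: module_hom_def Pi_iff)
qed

end

theorem corollary3p2:
  fixes k :: "('k, 'r) ring_scheme" and C :: "('k, 'c, 'e) module_scheme"
    and \<Delta> :: "'c \<Rightarrow> ('c \<times> 'c \<Rightarrow> 'k) set" and \<epsilon> :: "'c \<Rightarrow> 'k" and \<alpha> :: "'c \<Rightarrow> 'c"
    and l \<nu> :: 'k
  assumes "hom_coalgebra k C \<Delta> \<epsilon> \<alpha>"
    and "l \<in> carrier k - {\<zero>\<^bsub>k\<^esub>}" and "\<nu> \<in> carrier k - {\<zero>\<^bsub>k\<^esub>}"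
    and "\<forall>c\<in>carrier C. \<alpha> (\<alpha> c) = c"
  shows
    "let T = tensor_space k C C;
         b = (\<lambda>x y. (l \<otimes>\<^bsub>k\<^esub> \<epsilon> x) \<odot>\<^bsub>T\<^esub> \<Delta> y \<oplus>\<^bsub>T\<^esub> (\<nu> \<otimes>\<^bsub>k\<^esub> \<epsilon> y) \<odot>\<^bsub>T\<^esub> \<Delta> x
                \<ominus>\<^bsub>T\<^esub> l \<odot>\<^bsub>T\<^esub> tensor k C C (\<alpha> x) (\<alpha> y));
         b' = (\<lambda>x y. (inv\<^bsub>k\<^esub> \<nu> \<otimes>\<^bsub>k\<^esub> \<epsilon> x) \<odot>\<^bsub>T\<^esub> \<Delta> y \<oplus>\<^bsub>T\<^esub> (inv\<^bsub>k\<^esub> l \<otimes>\<^bsub>k\<^esub> \<epsilon> y) \<odot>\<^bsub>T\<^esub> \<Delta> x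
                \<ominus>\<^bsub>T\<^esub> inv\<^bsub>k\<^esub> l \<odot>\<^bsub>T\<^esub> tensor k C C (\<alpha> x) (\<alpha> y));
         B = tensor_lift k C C T b;
         B' = tensor_lift k C C T b'
     in linear_map k T T B
      \<and> (\<forall>x\<in>carrier C. \<forall>y\<in>carrier C. B (tensor k C C x y) = b x y)
      \<and> linear_map k T T B'
      \<and> (\<forall>x\<in>carrier C. \<forall>y\<in>carrier C. B' (tensor k C C x y) = b' x y)
      \<and> bij_betw B (carrier T) (carrier T)
      \<and> (\<forall>t\<in>carrier T. inv_into (carrier T) B t = B' t)"
proof -
  interpret hom_coalgebra k C \<Delta> \<epsilon> \<alpha> by (rule assms(1))
  have scalars: "l \<in> carrier k" "\<nu> \<in> carrier k" "inv\<^bsub>k\<^esub> l \<in> carrier k" "inv\<^bsub>k\<^esub> \<nu> \<in> carrier k"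
    using assms(2,3) by auto
  have units: "l \<otimes>\<^bsub>k\<^esub> inv\<^bsub>k\<^esub> l = \<one>\<^bsub>k\<^esub>" "inv\<^bsub>k\<^esub> l \<otimes>\<^bsub>k\<^esub> l = \<one>\<^bsub>k\<^esub>"
    "\<nu> \<otimes>\<^bsub>k\<^esub> inv\<^bsub>k\<^esub> \<nu> = \<one>\<^bsub>k\<^esub>" "inv\<^bsub>k\<^esub> \<nu> \<otimes>\<^bsub>k\<^esub> \<nu> = \<one>\<^bsub>k\<^esub>"
    using assms(2,3) C.field.field_Units by auto
  let ?b = "braid l \<nu> l" and ?b' = "braid (inv\<^bsub>k\<^esub> \<nu>) (inv\<^bsub>k\<^esub> l) (inv\<^bsub>k\<^esub> l)"
  let ?B = "tensor_lift k C C T ?b" and ?B' = "tensor_lift k C C T ?b'"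
  note b = braid_bilinear[OF scalars(1,2,1)] and b' = braid_bilinear[OF scalars(4,3,3)]
  note lift = CC.tensor_lift_linear[OF comul.W.module.module_axioms] CC.tensor_lift_tensor[OF comul.W.module.module_axioms]
  interpret B: linear_map k T T ?B by (rule lift(1)[OF b])
  interpret B': linear_map k T T ?B' by (rule lift(1)[OF b'])
  have B'B: "?B' (?B t) = t" if "t \<in> carrier T" for t
  proof (rule braid_lift_inverse[OF B.T_hom scalars(1,2,1) lift(2)[OF b]
        B'.T_hom scalars(4,3,3) lift(2)[OF b'] _ _ _ _ that])
    have sum: "inv\<^bsub>k\<^esub> \<nu> \<oplus>\<^bsub>k\<^esub> inv\<^bsub>k\<^esub> l \<ominus>\<^bsub>k\<^esub> inv\<^bsub>k\<^esub> l = inv\<^bsub>k\<^esub> \<nu>"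
      using scalars by (simp add: a_minus_def C.module.R.a_assoc C.module.R.r_neg)
    show "l \<otimes>\<^bsub>k\<^esub> (inv\<^bsub>k\<^esub> \<nu> \<oplus>\<^bsub>k\<^esub> inv\<^bsub>k\<^esub> l \<ominus>\<^bsub>k\<^esub> inv\<^bsub>k\<^esub> l) = l \<otimes>\<^bsub>k\<^esub> inv\<^bsub>k\<^esub> \<nu>"
      and "\<nu> \<otimes>\<^bsub>k\<^esub> (inv\<^bsub>k\<^esub> \<nu> \<oplus>\<^bsub>k\<^esub> inv\<^bsub>k\<^esub> l \<ominus>\<^bsub>k\<^esub> inv\<^bsub>k\<^esub> l) = l \<otimes>\<^bsub>k\<^esub> inv\<^bsub>k\<^esub> l"
      by (simp_all add: sum units)
  qed (use units assms(4) in auto)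
  have BB': "?B (?B' t) = t" if "t \<in> carrier T" for t
  proof (rule braid_lift_inverse[OF B'.T_hom scalars(4,3,3) lift(2)[OF b']
        B.T_hom scalars(1,2,1) lift(2)[OF b] _ _ _ _ that])
    have sum: "l \<oplus>\<^bsub>k\<^esub> \<nu> \<ominus>\<^bsub>k\<^esub> l = \<nu>"
      using scalars by (simp add: a_minus_def C.module.R.a_comm[of l \<nu>] C.module.R.a_assoc C.module.R.r_neg)
    show "inv\<^bsub>k\<^esub> \<nu> \<otimes>\<^bsub>k\<^esub> (l \<oplus>\<^bsub>k\<^esub> \<nu> \<ominus>\<^bsub>k\<^esub> l) = inv\<^bsub>k\<^esub> l \<otimes>\<^bsub>k\<^esub> l"
      and "inv\<^bsub>k\<^esub> l \<otimes>\<^bsub>k\<^esub> (l \<oplus>\<^bsub>k\<^esub> \<nu> \<ominus>\<^bsub>k\<^esub> l) = inv\<^bsub>k\<^esub> l \<otimes>\<^bsub>k\<^esub> \<nu>"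
      by (simp_all add: sum units)
  qed (use units assms(4) in auto)
  have bij: "bij_betw ?B (carrier T) (carrier T)"
    by (rule bij_betw_byWitness[where f' = ?B']) (use B'B BB' in auto)
  have "inv_into (carrier T) ?B t = ?B' t" if "t \<in> carrier T" for t
    using bij that BB'[OF that] by (intro inv_into_f_eq) (auto simp: bij_betw_def)
  with bij have "linear_map k T T ?B
      \<and> (\<forall>x\<in>carrier C. \<forall>y\<in>carrier C. ?B (x \<otimes>\<^sub>t y) = ?b x y)
      \<and> linear_map k T T ?B'
      \<and> (\<forall>x\<in>carrier C. \<forall>y\<in>carrier C. ?B' (x \<otimes>\<^sub>t y) = ?b' x y)
      \<and> bij_betw ?B (carrier T) (carrier T)
      \<and> (\<forall>t\<in>carrier T. inv_into (carrier T) ?B t = ?B' t)"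
    using lift[OF b] lift[OF b'] by (intro conjI) simp_all
  then show ?thesis
    unfolding Let_def braid_def[abs_def] .
qed

end
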